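(* The quotient monoid $\overline{\mathcal M}=\mathcal M/{\sim}$ is a group isomorphic to the dihedral group $\mathcal D_6$ of order $12$; in particular $\bar S^2=\bar T^6=(\bar S\bar T)^2=\mathrm{id}$.
   Context: Let $\mathcal E$ be the set of twelve tuples $(\varepsilon_1,\varepsilon_2,\varepsilon_3;k)$ with $\varepsilon_j\in\{\pm1\}$, $k\in\{1,2,3\}$, such that exactly one index $j$ satisfies $\varepsilon_j\ne\varepsilon_k$. For $E=(\varepsilon_1,\varepsilon_2,\varepsilon_3;k)\in\mathcal E$ define $K(E)=k$, $S(E)$ = the index $j\ne k$ with $\varepsilon_j\ne\varepsilon_k$, $T(E)$ = the index $j\ne k$ with $\varepsilon_j=\varepsilon_k$. Define $E^S$ as the tuple obtained from $E$ by negating the signs in positions $k$ and $S(E)$ and replacing the label $k$ by $S(E)$; define $E^T$ as the tuple obtained from $E$ by negating the sign in position $T(E)$ and replacing the label $k$ by $T(E)$ (both lie in $\mathcal E$). (This is the rule governing how the tropical signs and the last mutation index of rank $3$ cluster-cyclic exchange matrices change under the two possible mutations on a branch.) Let $\mathcal M$ be the free monoid on letters $S,T$, acting on $\mathcal E$ on the right by $E^{XY}=(E^X)^Y$. Define $X\sim Y$ iff $E^X=E^Y$ for all $E\in\mathcal E$; $\overline{\mathcal M}=\mathcal M/{\sim}$ is the quotient monoid, $\bar X$ the class of $X$, and $\mathrm{id}$ the class of the empty word. *)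

theory Defs
  imports "HOL-Algebra.Coset" "HOL-Library.Numeral_Type"
begin

text \<open>
  The index set $\{1,2,3\}$ is the three-element type \<open>3\<close>, whose elements are
  \<open>1\<close>, \<open>2\<close> and \<open>3 = 0\<close>.  A tuple
  $(\varepsilon_1,\varepsilon_2,\varepsilon_3;k)$ is the pair \<open>(\<epsilon>, k)\<close>.
\<close>

type_synonym sign_tuple = "(3 \<Rightarrow> int) \<times> 3"

definition sign_tuples :: "sign_tuple set" where
  "sign_tuples = {(\<epsilon>, k). (\<forall>j. \<epsilon> j \<in> {1, -1}) \<and> (\<exists>!j. \<epsilon> j \<noteq> \<epsilon> k)}"

definition K_index :: "sign_tuple \<Rightarrow> 3" where
  "K_index E = snd E"

definition S_index :: "sign_tuple \<Rightarrow> 3" where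
  "S_index E = (THE j. j \<noteq> K_index E \<and> fst E j \<noteq> fst E (K_index E))"

definition T_index :: "sign_tuple \<Rightarrow> 3" where
  "T_index E = (THE j. j \<noteq> K_index E \<and> fst E j = fst E (K_index E))"

definition S_move :: "sign_tuple \<Rightarrow> sign_tuple" where
  "S_move E =
    (\<lambda>j. if j = K_index E \<or> j = S_index E then - fst E j else fst E j, S_index E)"

definition T_move :: "sign_tuple \<Rightarrow> sign_tuple" where
  "T_move E = (\<lambda>j. if j = T_index E then - fst E j else fst E j, T_index E)"

datatype letter = S | T

definition free_monoid :: "'a list monoid" where
  "free_monoid = \<lparr>carrier = UNIV, mult = (@), one = []\<rparr>"

primrec move :: "letter \<Rightarrow> sign_tuple \<Rightarrow> sign_tuple" where
  "move S = S_move"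
| "move T = T_move"

text \<open>\<open>act E X\<close> is $E^X$; the leftmost letter acts first.\<close>

definition act :: "sign_tuple \<Rightarrow> letter list \<Rightarrow> sign_tuple" where
  "act E X = foldl (\<lambda>F x. move x F) E X"

lemma act_Nil [simp]: "act E [] = E"
  by (simp add: act_def)

lemma act_append: "act E (X @ Y) = act (act E X) Y"
  by (simp add: act_def)

definition act_equiv :: "(letter list \<times> letter list) set" where
  "act_equiv = {(X, Y). \<forall>E \<in> sign_tuples. act E X = act E Y}"

text \<open>
  Quotient of a monoid by a congruence \<open>r\<close>.  For classes \<open>A\<close> and \<open>B\<close>, all sets in the
  union are the same class, that of any product of representatives.
\<close>

definition quotient_monoid :: "('a, 'b) monoid_scheme \<Rightarrow> ('a \<times> 'a) set \<Rightarrow> 'a set monoid" where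
  "quotient_monoid G r =
    \<lparr>carrier = carrier G // r,
     mult = (\<lambda>A B. \<Union>x\<in>A. \<Union>y\<in>B. r `` {x \<otimes>\<^bsub>G\<^esub> y}),
     one = r `` {\<one>\<^bsub>G\<^esub>}\<rparr>"

definition M_bar :: "letter list set monoid" where
  "M_bar = quotient_monoid free_monoid act_equiv"

definition word_class :: "letter list \<Rightarrow> letter list set" where
  "word_class X = act_equiv `` {X}"

text \<open>
  The dihedral group of order \<open>2 n\<close> (for \<open>n \<ge> 1\<close>) as the semidirect product of
  $\mathbb{Z}/n$ with $\mathbb{Z}/2$ acting by inversion: \<open>(a, b)\<close> stands for $r^a s^b$,
  with $r$ the rotation and $s$ a reflection, so that $s r s = r^{-1}$.
\<close>

definition dihedral_group :: "nat \<Rightarrow> (int \<times> bool) monoid" where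
  "dihedral_group n =
    \<lparr>carrier = {0..<int n} \<times> UNIV,
     mult = (\<lambda>(a, b) (c, d). ((if b then a - c else a + c) mod int n, b \<noteq> d)),
     one = (0, False)\<rparr>"

lemma exhaust_index: "(i::3) = 1 \<or> i = 2 \<or> i = 3"
proof (induct i)
  case (of_int z)
  then have "z = 0 \<or> z = 1 \<or> z = 2" by fastforce
  then show ?case by auto
qed

lemma forall_index: "(\<forall>i::3. P i) \<longleftrightarrow> P 1 \<and> P 2 \<and> P 3"
  by (metis exhaust_index)

lemma ex_index: "(\<exists>i::3. P i) \<longleftrightarrow> P 1 \<or> P 2 \<or> P 3"
  by (metis exhaust_index)

lemma other_indices:
  assumes "(\<epsilon>, k) \<in> sign_tuples"
  obtains s t where "s \<noteq> k" "t \<noteq> k" "s \<noteq> t" "\<And>j. j = k \<or> j = s \<or> j = t"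
    "\<epsilon> s = - \<epsilon> k" "\<epsilon> t = \<epsilon> k" "\<epsilon> k = 1 \<or> \<epsilon> k = -1"
    "S_index (\<epsilon>, k) = s" "T_index (\<epsilon>, k) = t"
proof -
  have sg: "\<And>j. \<epsilon> j = 1 \<or> \<epsilon> j = -1" and ex: "\<exists>!j. \<epsilon> j \<noteq> \<epsilon> k"
    using assms by (auto simp: sign_tuples_def)
  obtain s where s: "\<epsilon> s \<noteq> \<epsilon> k" "\<And>j. \<epsilon> j \<noteq> \<epsilon> k \<Longrightarrow> j = s"
    using ex by blast
  have sk: "s \<noteq> k" using s(1) by blast
  have "\<exists>t. t \<noteq> k \<and> t \<noteq> s \<and> (\<forall>j. j = k \<or> j = s \<or> j = t)"
    using sk exhaust_index[of k] exhaust_index[of s]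
    by (elim disjE; simp add: forall_index ex_index)
  then obtain t where t: "t \<noteq> k" "t \<noteq> s" "\<And>j. j = k \<or> j = s \<or> j = t"
    by blast
  have et: "\<epsilon> t = \<epsilon> k" using s(2)[of t] t(2) by blast
  have "S_index (\<epsilon>, k) = s"
    unfolding S_index_def K_index_def fst_conv snd_conv
    by (rule the_equality) (use s sk in blast)+
  moreover have "T_index (\<epsilon>, k) = t"
    unfolding T_index_def K_index_def fst_conv snd_conv
  proof (rule the_equality)
    show "t \<noteq> k \<and> \<epsilon> t = \<epsilon> k" using t(1) et by blast
    show "j = t" if "j \<noteq> k \<and> \<epsilon> j = \<epsilon> k" for j
      using that t(3)[of j] s(1) by blast
  qed
  moreover have "\<epsilon> s = - \<epsilon> k" using s(1) sg[of s] sg[of k] by auto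
  ultimately show thesis using that[of s t] sk t et sg[of k] by blast
qed

lemma S_move_closed: "E \<in> sign_tuples \<Longrightarrow> S_move E \<in> sign_tuples"
proof (cases E)
  case (Pair \<epsilon> k)
  assume "E \<in> sign_tuples"
  with Pair obtain s t where "s \<noteq> k" "t \<noteq> k" "s \<noteq> t" and ex: "\<And>j. j = k \<or> j = s \<or> j = t"
    and e: "\<epsilon> s = - \<epsilon> k" "\<epsilon> t = \<epsilon> k" "\<epsilon> k = 1 \<or> \<epsilon> k = -1"
      "S_index (\<epsilon>, k) = s" by (metis other_indices)
  then have ne: "s \<noteq> k" "t \<noteq> k" "s \<noteq> t" "k \<noteq> s" "k \<noteq> t" "t \<noteq> s" by auto
  define \<delta> where "\<delta> = fst (S_move E)"
  have d: "\<delta> k = - \<epsilon> k" "\<delta> s = \<epsilon> k" "\<delta> t = \<epsilon> k" "S_move E = (\<delta>, s)"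
    using Pair ne e by (auto simp: \<delta>_def S_move_def K_index_def)
  have "\<delta> j \<in> {1, -1}" for j using ex[of j] d e by auto
  moreover have "\<exists>!j. \<delta> j \<noteq> \<delta> s"
    by (rule ex1I[of _ k]) (use d e ex in \<open>force, metis\<close>)
  ultimately show ?thesis by (simp add: d(4) sign_tuples_def)
qed

lemma T_move_closed: "E \<in> sign_tuples \<Longrightarrow> T_move E \<in> sign_tuples"
proof (cases E)
  case (Pair \<epsilon> k)
  assume "E \<in> sign_tuples"
  with Pair obtain s t where "s \<noteq> k" "t \<noteq> k" "s \<noteq> t" and ex: "\<And>j. j = k \<or> j = s \<or> j = t"
    and e: "\<epsilon> s = - \<epsilon> k" "\<epsilon> t = \<epsilon> k" "\<epsilon> k = 1 \<or> \<epsilon> k = -1"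
      "T_index (\<epsilon>, k) = t" by (metis other_indices)
  then have ne: "s \<noteq> k" "t \<noteq> k" "s \<noteq> t" "k \<noteq> s" "k \<noteq> t" "t \<noteq> s" by auto
  define \<delta> where "\<delta> = fst (T_move E)"
  have d: "\<delta> k = \<epsilon> k" "\<delta> s = - \<epsilon> k" "\<delta> t = - \<epsilon> k" "T_move E = (\<delta>, t)"
    using Pair ne e by (auto simp: \<delta>_def T_move_def K_index_def)
  have "\<delta> j \<in> {1, -1}" for j using ex[of j] d e by auto
  moreover have "\<exists>!j. \<delta> j \<noteq> \<delta> t"
    by (rule ex1I[of _ k]) (use d e ex in \<open>force, metis\<close>)
  ultimately show ?thesis by (simp add: d(4) sign_tuples_def)
qed

lemma act_closed: "E \<in> sign_tuples \<Longrightarrow> act E X \<in> sign_tuples"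
proof (induction X arbitrary: E)
  case (Cons x X)
  have "act E (x # X) = act (move x E) X" by (simp add: act_def)
  moreover have "move x E \<in> sign_tuples"
    using Cons.prems by (cases x) (auto intro: S_move_closed T_move_closed)
  ultimately show ?case using Cons.IH by simp
qed simp

lemma equiv_act_equiv: "equiv UNIV act_equiv"
  by (rule equivI) (auto simp: act_equiv_def refl_on_def sym_def trans_def)

lemma act_equiv_append:
  "\<lbrakk>(X, X') \<in> act_equiv; (Y, Y') \<in> act_equiv\<rbrakk> \<Longrightarrow> (X @ Y, X' @ Y') \<in> act_equiv"
  by (auto simp: act_equiv_def act_append act_closed)

lemma M_bar_mult: "word_class X \<otimes>\<^bsub>M_bar\<^esub> word_class Y = word_class (X @ Y)"
proof -
  have "act_equiv `` {x @ y} = act_equiv `` {X @ Y}"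
    if "x \<in> word_class X" "y \<in> word_class Y" for x y
    using that equiv_class_eq[OF equiv_act_equiv] act_equiv_append
    unfolding word_class_def by (metis Image_singleton_iff)
  then have "(\<Union>x\<in>word_class X. \<Union>y\<in>word_class Y. act_equiv `` {x @ y})
      = (\<Union>x\<in>word_class X. \<Union>y\<in>word_class Y. word_class (X @ Y))"
    by (simp add: word_class_def)
  moreover have "X \<in> word_class X" "Y \<in> word_class Y"
    by (auto simp: word_class_def act_equiv_def)
  ultimately show ?thesis
    by (auto simp: M_bar_def quotient_monoid_def free_monoid_def)
qed

lemma group_dihedral_group:
  assumes "n > 0"
  shows "group (dihedral_group n)"
proof (rule groupI)
  fix x assume "x \<in> carrier (dihedral_group n)"
  then obtain a b where x: "x = (a, b)" "0 \<le> a" "a < int n"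
    by (auto simp: dihedral_group_def)
  show "\<exists>y\<in>carrier (dihedral_group n). y \<otimes>\<^bsub>dihedral_group n\<^esub> x = \<one>\<^bsub>dihedral_group n\<^esub>"
    by (rule bexI[of _ "(if b then a else (- a) mod int n, b)"])
      (use x assms in \<open>auto simp: dihedral_group_def mod_simps\<close>)
next
  fix x y z :: "int \<times> bool"
  obtain a b c d e f where "x = (a, b)" "y = (c, d)" "z = (e, f)"
    by (cases x, cases y, cases z) blast
  then show "x \<otimes>\<^bsub>dihedral_group n\<^esub> y \<otimes>\<^bsub>dihedral_group n\<^esub> z =
      x \<otimes>\<^bsub>dihedral_group n\<^esub> (y \<otimes>\<^bsub>dihedral_group n\<^esub> z)"
    by (cases b; cases d)
      (simp_all add: dihedral_group_def mod_simps add.assoc add_diff_eq diff_diff_eq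
        diff_diff_eq2 diff_add_eq)
qed (use assms in \<open>auto simp: dihedral_group_def\<close>)

lemma order_dihedral_group: "order (dihedral_group n) = 2 * n"
  by (simp add: order_def dihedral_group_def card_cartesian_product)

lemma card_sign_tuples: "card sign_tuples = 12"
proof -
  define A :: "(3 \<times> 3 \<times> int) set" where "A = (SIGMA k:UNIV. (UNIV - {k}) \<times> {1, -1})"
  define f :: "3 \<times> 3 \<times> int \<Rightarrow> sign_tuple"
    where "f = (\<lambda>(k, s, x). (\<lambda>j. if j = s then - x else x, k))"
  have "card A = 12"
    by (simp add: A_def card_SigmaI card_cartesian_product card_Diff_singleton)
  moreover have "inj_on f A"
  proof (rule inj_onI)
    fix p q assume p: "p \<in> A" and q: "q \<in> A" and eq: "f p = f q"
    obtain k s x where P: "p = (k, s, x)" by (cases p)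
    obtain k' s' x' where Q: "q = (k', s', x')" by (cases q)
    have k: "k' = k" and e: "\<And>j. (if j = s then - x else x) = (if j = s' then - x' else x')"
      using eq P Q by (auto simp: f_def fun_eq_iff)
    have "s \<noteq> k" "s' \<noteq> k" "x \<noteq> - x" using p q P Q k by (auto simp: A_def)
    then show "p = q" using e[of k] e[of s] P Q k by (auto split: if_splits)
  qed
  moreover have "f ` A = sign_tuples"
  proof
    show "f ` A \<subseteq> sign_tuples"
      by (auto simp: f_def A_def sign_tuples_def split: if_splits)
    show "sign_tuples \<subseteq> f ` A"
    proof
      fix E assume E: "E \<in> sign_tuples"
      obtain \<epsilon> k where Ek: "E = (\<epsilon>, k)" by (cases E)
      obtain s t where st: "s \<noteq> k" "t \<noteq> k" "s \<noteq> t" "\<And>j. j = k \<or> j = s \<or> j = t"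
        "\<epsilon> s = - \<epsilon> k" "\<epsilon> t = \<epsilon> k" "\<epsilon> k = 1 \<or> \<epsilon> k = -1"
        by (rule other_indices[OF E[unfolded Ek]]) blast
      have eq: "\<epsilon> = (\<lambda>j. if j = s then - \<epsilon> k else \<epsilon> k)"
      proof
        fix j show "\<epsilon> j = (if j = s then - \<epsilon> k else \<epsilon> k)"
          using st(4)[of j] st(5,6) by (cases "j = s") auto
      qed
      have "E = f (k, s, \<epsilon> k)"
        unfolding f_def Ek prod.case prod.inject using eq by blast
      moreover have "(k, s, \<epsilon> k) \<in> A" using st by (auto simp: A_def)
      ultimately show "E \<in> f ` A" by blast
    qed
  qed
  ultimately show ?thesis by (metis card_image)
qed

end

theory Submission
  imports Defs
begin

text \<open>
  An element of \<open>sign_tuples\<close> with label \<open>k\<close> and $S(E) = s$, $T(E) = t$ is determined by the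
  ordering $(k, s, t)$ of the indices and the sign \<open>x\<close> in position \<open>k\<close>.  In these coordinates
  $S$ sends $(k, s, t; x)$ to $(s, k, t; x)$ and $T$ sends it to $(t, k, s; -x)$, so
  $S^2$, $T^6$ and $(ST)^2$ act trivially.  Hence the quotient is a group and the image of the
  dihedral group; no nontrivial $T^a S^b$ with $0 \le a < 6$ acts trivially, so the map is injective.
\<close>

section \<open>Coordinates for sign tuples, and the two moves in them\<close>

definition frame :: "3 \<Rightarrow> 3 \<Rightarrow> int \<Rightarrow> sign_tuple" where
  "frame k s x = (\<lambda>j. if j = s then - x else x, k)"

lemma index_cases:
  fixes k s t j :: 3
  assumes "distinct [k, s, t]"
  shows "j = k \<or> j = s \<or> j = t"
  using assms exhaust_index[of k] exhaust_index[of s] exhaust_index[of t] exhaust_index[of j]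
  by (elim disjE) simp_all

lemma frame_eq_iff:
  assumes "s \<noteq> k" "s' \<noteq> k'" "x \<in> {1, -1}" "x' \<in> {1, -1}"
  shows "frame k s x = frame k' s' x' \<longleftrightarrow> k = k' \<and> s = s' \<and> x = x'"
proof
  assume eq: "frame k s x = frame k' s' x'"
  have k: "k = k'" and e: "\<And>j. (if j = s then - x else x) = (if j = s' then - x' else x')"
    using eq by (auto simp: frame_def fun_eq_iff)
  \<comment> \<open>Position \<open>k\<close> differs from both \<open>s\<close> and
    \<open>s'\<close>, so it yields \<open>x = x'\<close>; position \<open>s\<close> then forces
    \<open>s = s'\<close>, because a sign is never its own negative.\<close>
  show "k = k' \<and> s = s' \<and> x = x'"
    using e[of k] e[of s] k assms by (auto split: if_splits)
qed simp

lemma frame_in_sign_tuples: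
  "\<lbrakk>s \<noteq> k; x \<in> {1, -1}\<rbrakk> \<Longrightarrow> frame k s x \<in> sign_tuples"
  by (auto simp: frame_def sign_tuples_def)

text \<open>Flipping \<open>k\<close> and \<open>s\<close> moves the deviating sign from
  \<open>s\<close> to \<open>k\<close>, and the new label \<open>s\<close> now carries the majority
  sign \<open>x\<close>.\<close>

lemma S_move_frame:
  assumes "distinct [k, s, t]" "x \<in> {1, -1}"
  shows "S_move (frame k s x) = frame s k x"
proof -
  have "S_index (frame k s x) = s"
    unfolding S_index_def K_index_def frame_def
    by (rule the_equality) (use assms in \<open>auto split: if_splits\<close>)
  then show ?thesis
    using assms by (auto simp: S_move_def K_index_def frame_def fun_eq_iff)
qed

text \<open>Once flipped, \<open>t\<close> agrees with \<open>s\<close> on \<open>- x\<close>, so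
  \<open>k\<close>, which keeps \<open>x\<close>, becomes the deviating position. Its identification
  needs that \<open>k\<close>, \<open>s\<close>, \<open>t\<close> exhaust the index type.\<close>

lemma T_move_frame:
  assumes "distinct [k, s, t]" "x \<in> {1, -1}"
  shows "T_move (frame k s x) = frame t k (- x)"
proof -
  have "T_index (frame k s x) = t"
    unfolding T_index_def K_index_def frame_def
    by (rule the_equality) (use assms index_cases[OF assms(1)] in \<open>auto split: if_splits\<close>)
  then show ?thesis
    using assms index_cases[OF assms(1)] by (auto simp: T_move_def frame_def fun_eq_iff)
qed

lemma act_Cons: "act E (x # X) = act (move x E) X"
  by (simp add: act_def)

lemma sign_tuples_frameE:
  assumes "E \<in> sign_tuples"
  obtains k s t x where "distinct [k, s, t]" "x \<in> {1, -1}" "E = frame k s x"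
proof -
  obtain \<epsilon> k where E: "E = (\<epsilon>, k)" by (cases E)
  obtain s t where st: "s \<noteq> k" "t \<noteq> k" "s \<noteq> t" "\<And>j. j = k \<or> j = s \<or> j = t"
    "\<epsilon> s = - \<epsilon> k" "\<epsilon> t = \<epsilon> k" "\<epsilon> k = 1 \<or> \<epsilon> k = -1"
    by (rule other_indices[OF assms[unfolded E]]) blast
  have "\<epsilon> j = (if j = s then - \<epsilon> k else \<epsilon> k)" for j
    using st(4)[of j] st(5,6) by (cases "j = s") auto
  then have "E = frame k s (\<epsilon> k)"
    unfolding E frame_def by (intro arg_cong2[where f = Pair] ext) simp_all
  then show thesis
    using that[of k s t "\<epsilon> k"] st by auto
qed

section \<open>Relations between word classes, checked on frames\<close>

lemma word_class_eq_iff: "word_class X = word_class Y \<longleftrightarrow> (X, Y) \<in> act_equiv"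
  using eq_equiv_class_iff[OF equiv_act_equiv] by (simp add: word_class_def)

lemma word_class_eqI:
  assumes "\<And>k s t x. \<lbrakk>distinct [k, s, t]; x \<in> {1, -1}\<rbrakk>
    \<Longrightarrow> act (frame k s x) X = act (frame k s x) Y"
  shows "word_class X = word_class Y"
  unfolding word_class_eq_iff act_equiv_def
  using assms by (auto elim!: sign_tuples_frameE)

lemma act_S_frame:
  "\<lbrakk>distinct [k, s, t]; x \<in> {1, -1}\<rbrakk> \<Longrightarrow> act (frame k s x) (S # X) = act (frame s k x) X"
  by (simp only: act_Cons move.simps S_move_frame)

lemma act_T_frame:
  "\<lbrakk>distinct [k, s, t]; x \<in> {1, -1}\<rbrakk> \<Longrightarrow> act (frame k s x) (T # X) = act (frame t k (- x)) X"
  by (simp only: act_Cons move.simps T_move_frame)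

lemma S_square: "word_class [S, S] = word_class []"
proof (rule word_class_eqI)
  fix k s t :: 3 and x :: int
  assume "distinct [k, s, t]" "x \<in> {1, -1}"
  then show "act (frame k s x) [S, S] = act (frame k s x) []"
    using act_S_frame[of k s t x] act_S_frame[of s k t x] by auto
qed

text \<open>\<open>T\<close> rotates the ordering of the three indices and negates the sign. Three
  rotations restore the ordering, while three negations leave one sign change; doing this twice
  gives the sixth power.\<close>

lemma act_T_cube:
  assumes "distinct [k, s, t]" "x \<in> {1, -1}"
  shows "act (frame k s x) (T # T # T # X) = act (frame k s (- x)) X"
  using assms act_T_frame[of k s t x] act_T_frame[of t k s "- x"] act_T_frame[of s t k x] by auto

lemma T_sixth: "word_class [T, T, T, T, T, T] = word_class []"
proof (rule word_class_eqI)
  fix k s t :: 3 and x :: int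
  assume "distinct [k, s, t]" "x \<in> {1, -1}"
  then show "act (frame k s x) [T, T, T, T, T, T] = act (frame k s x) []"
    using act_T_cube[of k s t x] act_T_cube[of k s t "- x"] by auto
qed

text \<open>The word \<open>[S, T]\<close> exchanges \<open>k\<close> and \<open>t\<close>, fixes
  \<open>s\<close> and negates \<open>x\<close>, which is an involution.\<close>

lemma ST_square: "word_class [S, T, S, T] = word_class []"
proof (rule word_class_eqI)
  fix k s t :: 3 and x :: int
  assume "distinct [k, s, t]" "x \<in> {1, -1}"
  then show "act (frame k s x) [S, T, S, T] = act (frame k s x) []"
    using act_S_frame[of k s t x] act_T_frame[of s k t x]
      act_S_frame[of t s k "- x"] act_T_frame[of s t k "- x"] by auto
qed

section \<open>Group structure of the quotient\<close>

lemma carrier_M_bar: "carrier M_bar = range word_class"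
  by (auto simp: M_bar_def quotient_monoid_def free_monoid_def quotient_def word_class_def)

lemma one_M_bar: "\<one>\<^bsub>M_bar\<^esub> = word_class []"
  by (simp add: M_bar_def quotient_monoid_def free_monoid_def word_class_def)

lemma word_class_in_carrier [simp]: "word_class X \<in> carrier M_bar"
  by (simp add: carrier_M_bar)

text \<open>Each letter has a left inverse: \<open>S\<close> itself, and five copies of
  \<open>T\<close> for \<open>T\<close>. In the product these cancel from the middle outwards, the
  first letter before the rest.\<close>

lemma word_class_left_inverse: "\<exists>Y. word_class (Y @ X) = word_class []"
proof (induction X)
  case (Cons x X)
  then obtain Y where Y: "word_class (Y @ X) = word_class []" by blast
  obtain Z where Z: "word_class (Z @ [x]) = word_class []"
  proof (cases x)
    case S
    then show ?thesis using that[of "[S]"] S_square by simp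
  next
    case T
    then show ?thesis using that[of "[T, T, T, T, T]"] T_sixth by simp
  qed
  have "word_class ((Y @ Z) @ x # X) = word_class (Y @ (Z @ [x]) @ X)" by simp
  also have "\<dots> = word_class Y \<otimes>\<^bsub>M_bar\<^esub> (word_class (Z @ [x]) \<otimes>\<^bsub>M_bar\<^esub> word_class X)"
    by (simp only: M_bar_mult)
  also have "\<dots> = word_class []"
    by (simp add: Z Y M_bar_mult)
  finally show ?case by blast
qed (auto intro: exI[of _ "[]"])

lemma group_M_bar: "group M_bar"
proof (rule groupI)
  fix x assume "x \<in> carrier M_bar"
  then show "\<exists>y\<in>carrier M_bar. y \<otimes>\<^bsub>M_bar\<^esub> x = \<one>\<^bsub>M_bar\<^esub>"
    using word_class_left_inverse by (auto simp: carrier_M_bar one_M_bar M_bar_mult)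
qed (auto simp: carrier_M_bar M_bar_mult one_M_bar)

lemma word_class_replicate_pow:
  "word_class [x] [^]\<^bsub>M_bar\<^esub> (n::nat) = word_class (replicate n x)"
proof -
  interpret group M_bar by (rule group_M_bar)
  show ?thesis
  proof (induction n)
    case (Suc n)
    then show ?case by (simp add: M_bar_mult flip: replicate_append_same)
  qed (simp add: one_M_bar)
qed

section \<open>Homomorphisms from a dihedral group, obtained from its defining relations\<close>

lemma (in group) hom_dihedral_group:
  assumes r: "r \<in> carrier G" "r [^] n = \<one>"
    and s: "s \<in> carrier G" "s [^] (2::nat) = \<one>"
    and sr: "(s \<otimes> r) [^] (2::nat) = \<one>"
  shows "(\<lambda>(a, b). r [^] a \<otimes> (if b then s else \<one>)) \<in> hom (dihedral_group n) G"
proof -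
  have ss: "s \<otimes> s = \<one>"
    using s by (simp add: numeral_2_eq_2)
  have srsr: "s \<otimes> r \<otimes> (s \<otimes> r) = \<one>"
    using sr r s by (simp add: numeral_2_eq_2)
  \<comment> \<open>The relation on \<open>s \<otimes> r\<close> makes it its own inverse, and
    \<open>s\<close> is its own inverse too; expanding the inverse of the product gives the
    claim.\<close>
  have conj: "s \<otimes> r = inv r \<otimes> s"
  proof -
    have "s \<otimes> r = inv (s \<otimes> r)"
      using srsr r s by (metis inv_equality m_closed)
    also have "\<dots> = inv r \<otimes> s"
      using r s ss by (metis inv_equality inv_mult_group)
    finally show ?thesis .
  qed
  have conj_pow: "s \<otimes> r [^] m = inv r [^] m \<otimes> s" for m :: nat
  proof (induction m)
    case (Suc m)
    have "s \<otimes> r [^] Suc m = (s \<otimes> r [^] m) \<otimes> r"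
      using r s by (simp add: m_assoc)
    also have "\<dots> = inv r [^] m \<otimes> (s \<otimes> r)"
      unfolding Suc using r s by (simp add: m_assoc)
    also have "\<dots> = inv r [^] Suc m \<otimes> s"
      unfolding conj using r s by (simp add: m_assoc)
    finally show ?case .
  qed (use s in simp)
  \<comment> \<open>Nonnegative \<open>c\<close> is enough: it will be the rotation exponent of the
    second factor, which lies in \<open>{0..<int n}\<close>.\<close>
  have conj_int: "s \<otimes> r [^] c = r [^] (- c) \<otimes> s" if c: "0 \<le> c" for c :: int
  proof -
    have "s \<otimes> r [^] c = inv r [^] nat c \<otimes> s"
      using conj_pow[of "nat c"] c by (simp add: int_pow_int [symmetric])
    also have "inv r [^] nat c = r [^] (- c)"
      using c r by (simp add: int_pow_inv int_pow_neg flip: int_pow_int)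
    finally show ?thesis .
  qed
  \<comment> \<open>The product of \<open>dihedral_group n\<close> reduces exponents modulo
    \<open>n\<close>; powers of \<open>r\<close> do not see this reduction.\<close>
  have mod: "r [^] (c mod int n) = r [^] c" for c :: int
  proof -
    have "r [^] c = r [^] (int n * (c div int n) + c mod int n)"
      by simp
    also have "\<dots> = (r [^] int n) [^] (c div int n) \<otimes> r [^] (c mod int n)"
      using r by (simp only: int_pow_mult int_pow_pow)
    also have "\<dots> = r [^] (c mod int n)"
      using r by (simp add: int_pow_int)
    finally show ?thesis by simp
  qed
  show ?thesis
  proof (rule homI)
    fix p q assume "p \<in> carrier (dihedral_group n)" "q \<in> carrier (dihedral_group n)"
    then obtain a b c d where p: "p = (a, b)" and q: "q = (c, d)" and c: "0 \<le> c"
      by (auto simp: dihedral_group_def)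
    \<comment> \<open>Moving \<open>s\<close> to the right past a power of \<open>r\<close> negates
      the exponent, which accounts for \<open>a - c\<close> in the dihedral product.\<close>
    have mid: "(if b then s else \<one>) \<otimes> r [^] c
        = r [^] (if b then - c else c) \<otimes> (if b then s else \<one>)"
      using conj_int[OF c] r by simp
    have "(r [^] a \<otimes> (if b then s else \<one>)) \<otimes> (r [^] c \<otimes> (if d then s else \<one>))
        = r [^] a \<otimes> ((if b then s else \<one>) \<otimes> r [^] c) \<otimes> (if d then s else \<one>)"
      using r s by (simp add: m_assoc)
    also have "\<dots> = r [^] a \<otimes> r [^] (if b then - c else c)
        \<otimes> ((if b then s else \<one>) \<otimes> (if d then s else \<one>))"
      unfolding mid using r s by (simp add: m_assoc)
    also have "\<dots> = r [^] (if b then a - c else a + c) \<otimes> (if b \<noteq> d then s else \<one>)"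
      using r s ss by (simp add: int_pow_mult [symmetric])
    finally show "(case p \<otimes>\<^bsub>dihedral_group n\<^esub> q of (a, b) \<Rightarrow> r [^] a \<otimes> (if b then s else \<one>))
        = (case p of (a, b) \<Rightarrow> r [^] a \<otimes> (if b then s else \<one>))
          \<otimes> (case q of (a, b) \<Rightarrow> r [^] a \<otimes> (if b then s else \<one>))"
      using mod by (simp add: p q dihedral_group_def)
  qed (use r s in \<open>auto simp: dihedral_group_def\<close>)
qed

section \<open>Injectivity, surjectivity and the isomorphism\<close>

lemma normal_word_trivial:
  assumes eq: "word_class (replicate n T @ (if b then [S] else [])) = word_class []" and n: "n < 6"
  shows "n = 0 \<and> \<not> b"
proof -
  \<comment> \<open>A single tuple separates the normal words: powers of \<open>T\<close> stay among
    the even orderings of 1, 2, 3, where the ordering determines \<open>n\<close> modulo 3 and the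
    sign determines \<open>n\<close> modulo 2, and a final \<open>S\<close> leads to an odd
    ordering.\<close>
  let ?E = "frame 1 2 1"
  have "?E \<in> sign_tuples" by (simp add: frame_in_sign_tuples)
  then have act_E: "act ?E (replicate n T @ (if b then [S] else [])) = ?E"
    using eq by (auto simp: word_class_eq_iff act_equiv_def)
  have T: "act (frame 1 2 x) (T # X) = act (frame 3 1 (- x)) X"
    "act (frame 3 1 x) (T # X) = act (frame 2 3 (- x)) X"
    "act (frame 2 3 x) (T # X) = act (frame 1 2 (- x)) X" if "x \<in> {1, -1}" for x X
    using that by (auto intro!: act_T_frame)
  have S: "act (frame 1 2 x) (S # X) = act (frame 2 1 x) X"
    "act (frame 3 1 x) (S # X) = act (frame 1 3 x) X"
    "act (frame 2 3 x) (S # X) = act (frame 3 2 x) X" if "x \<in> {1, -1}" for x X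
    using that act_S_frame[of 1 2 3 x X] act_S_frame[of 3 1 2 x X] act_S_frame[of 2 3 1 x X] by auto
  consider "n = 0" | "n = 1" | "n = 2" | "n = 3" | "n = 4" | "n = 5"
    using n by linarith
  then show ?thesis
    using act_E
    by cases (auto simp: S T frame_eq_iff eval_nat_numeral split: if_splits)
qed

lemma M_bar_iso_dihedral_group: "M_bar \<cong> dihedral_group 6"
proof -
  interpret M: group M_bar by (rule group_M_bar)
  interpret D: group "dihedral_group 6" by (rule group_dihedral_group) simp
  \<comment> \<open>The map starts at the dihedral group because the relations of
    \<open>M_bar\<close> then suffice for the homomorphism property; its direction is reversed at
    the end by \<open>D.iso_sym\<close>.\<close>
  define f where "f = (\<lambda>(a::int, b). word_class [T] [^]\<^bsub>M_bar\<^esub> a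
    \<otimes>\<^bsub>M_bar\<^esub> (if b then word_class [S] else \<one>\<^bsub>M_bar\<^esub>))"
  have hom: "f \<in> hom (dihedral_group 6) M_bar"
    unfolding f_def
    by (rule M.hom_dihedral_group)
      (simp_all add: word_class_replicate_pow M_bar_mult one_M_bar S_square T_sixth ST_square
        eval_nat_numeral)
  interpret f: group_hom "dihedral_group 6" M_bar f
    by unfold_locales (rule hom)
  \<comment> \<open>A nonnegative integer exponent turns the image into the class of an actual word,
    to which \<open>normal_word_trivial\<close> applies.\<close>
  have f_word: "f (a, b) = word_class (replicate (nat a) T @ (if b then [S] else []))"
    if "0 \<le> a" for a b
    using that word_class_replicate_pow[of T "nat a"]
    by (simp add: f_def M_bar_mult one_M_bar int_pow_int [symmetric])
  have "inj_on f (carrier (dihedral_group 6))"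
    unfolding f.inj_on_one_iff
  proof (intro allI impI)
    fix p assume p: "p \<in> carrier (dihedral_group 6)" and fp: "f p = \<one>\<^bsub>M_bar\<^esub>"
    obtain a b where ab: "p = (a, b)" "0 \<le> a" "a < 6"
      using p by (auto simp: dihedral_group_def)
    then have "nat a = 0 \<and> \<not> b"
      using fp normal_word_trivial[of "nat a" b] by (simp add: f_word one_M_bar)
    then show "p = \<one>\<^bsub>dihedral_group 6\<^esub>"
      using ab by (simp add: dihedral_group_def)
  qed
  moreover have "f ` carrier (dihedral_group 6) = carrier M_bar"
  proof
    \<comment> \<open>The image is a subgroup containing the classes of both letters, hence the
      class of every word.\<close>
    show "carrier M_bar \<subseteq> f ` carrier (dihedral_group 6)"
    proof -
      interpret I: subgroup "f ` carrier (dihedral_group 6)" M_bar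
        by (rule f.img_is_subgroup)
      have "f (0, True) = word_class [S]" "f (1, False) = word_class [T]"
        by (simp_all add: f_word)
      moreover have "(0, True) \<in> carrier (dihedral_group 6)" "(1, False) \<in> carrier (dihedral_group 6)"
        by (simp_all add: dihedral_group_def)
      ultimately have gen: "word_class [x] \<in> f ` carrier (dihedral_group 6)" for x
        by (cases x) (metis imageI)+
      have "word_class X \<in> f ` carrier (dihedral_group 6)" for X
      proof (induction X)
        case Nil
        then show ?case using I.one_closed by (simp add: one_M_bar)
      next
        case (Cons x X)
        then show ?case using I.m_closed[OF gen[of x] Cons.IH] by (simp add: M_bar_mult)
      qed
      then show ?thesis by (auto simp: carrier_M_bar)
    qed
  qed (auto simp del: word_class_in_carrier)
  ultimately have "f \<in> iso (dihedral_group 6) M_bar"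
    using hom by (simp add: iso_def bij_betw_def)
  then show ?thesis
    using D.iso_sym is_isoI by blast
qed

theorem theorem6p11:
  shows "group M_bar \<and> M_bar \<cong> dihedral_group 6 \<and> order (dihedral_group 6) = 12
    \<and> word_class [S] [^]\<^bsub>M_bar\<^esub> (2::nat) = \<one>\<^bsub>M_bar\<^esub>
    \<and> word_class [T] [^]\<^bsub>M_bar\<^esub> (6::nat) = \<one>\<^bsub>M_bar\<^esub>
    \<and> (word_class [S] \<otimes>\<^bsub>M_bar\<^esub> word_class [T]) [^]\<^bsub>M_bar\<^esub> (2::nat) = \<one>\<^bsub>M_bar\<^esub>"
proof -
  interpret group M_bar by (rule group_M_bar)
  have "word_class [S] [^]\<^bsub>M_bar\<^esub> (2::nat) = \<one>\<^bsub>M_bar\<^esub>"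
    using S_square by (simp add: numeral_2_eq_2 M_bar_mult one_M_bar)
  moreover have "word_class [T] [^]\<^bsub>M_bar\<^esub> (6::nat) = \<one>\<^bsub>M_bar\<^esub>"
    using T_sixth unfolding word_class_replicate_pow one_M_bar by (simp add: eval_nat_numeral)
  moreover have "(word_class [S] \<otimes>\<^bsub>M_bar\<^esub> word_class [T]) [^]\<^bsub>M_bar\<^esub> (2::nat) = \<one>\<^bsub>M_bar\<^esub>"
    using ST_square by (simp add: numeral_2_eq_2 M_bar_mult one_M_bar)
  ultimately show ?thesis
    using group_M_bar M_bar_iso_dihedral_group by (simp add: order_dihedral_group)
qed

end
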